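(* Let $V$ be a finite-dimensional vector space over a field $\mathbb{F}$, let $n=\dim V$, fix coordinates on $V$ (identifying $V$ with $\mathbb{F}^n$), and let $A\subset V$ be a finite set. Let $s$ be a nonnegative integer and let $p(\vec{x},\vec{y})\in\mathbb{F}[x_1,\dots,x_n,y_1,\dots,y_n]$ be a $2n$-variate polynomial with coefficients in $\mathbb{F}$ of total degree at most $2s+1$. Let $M_{p,A}$ be the $A\times A$ matrix with entries $(M_{p,A})_{a,b}=p(\vec{a},\vec{b})$ for $a,b\in A$. It corresponds to the (not necessarily symmetric) bilinear form on $\mathbb{F}^A$ $$\Phi_p(f,g)=\sum_{a,b\in A} p(\vec{a},\vec{b})\, f(a)g(b),\qquad f,g:A\to\mathbb{F},$$ which defines the quadratic form $f\mapsto\Phi_p(f,f)$. Let $\mathrm{rank}(p,A)$ denote the rank of $M_{p,A}$; when $\mathbb{F}=\mathbb{R}$ let $r_+(p,A)$ and $r_-(p,A)$ denote the positive and negative inertia indices of the quadratic form $\Phi_p(f,f)$ on $\mathbb{R}^A$. Let $\dim_s(A)$ denote the dimension of the vector space of functions $A\to\mathbb{F}$ obtained by restricting to $A$ polynomials in $n$ variables over $\mathbb{F}$ of degree at most $s$. Then: (1) $\mathrm{rank}(p,A)\le 2\dim_s(A)$; (2) if $\mathbb{F}=\mathbb{R}$, then $\max\{r_+(p,A),\,r_-(p,A)\}\le \dim_s(A)$.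
   Context: The inertia indices $r_+$, $r_-$ of a real quadratic form are the number of positive, respectively negative, coefficients in a diagonal form of it (equivalently, the maximal dimension of a subspace on which the form is positive definite, respectively negative definite), as in Sylvester's Law of Inertia. *)

theory Defs
  imports Complex_Main "HOL-Library.Poly_Mapping" "HOL-Library.Function_Algebras"
begin

text \<open>
  Multivariate polynomials over \<open>'a\<close> in variables from \<open>'x\<close> are finitely supported maps from
  monomials to coefficients, a monomial being a finitely supported map from variables to exponents.
\<close>

type_synonym ('x, 'a) mpoly = "('x \<Rightarrow>\<^sub>0 nat) \<Rightarrow>\<^sub>0 'a"

definition polys_in :: "'x set \<Rightarrow> ('x, 'a::zero) mpoly set" where
  "polys_in X = {p. \<forall>m\<in>Poly_Mapping.keys p. Poly_Mapping.keys m \<subseteq> X}"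

definition monom_degree :: "('x \<Rightarrow>\<^sub>0 nat) \<Rightarrow> nat" where
  "monom_degree m = (\<Sum>i\<in>Poly_Mapping.keys m. Poly_Mapping.lookup m i)"

text \<open>The zero polynomial gets total degree \<open>0\<close>; it thus satisfies every bound on the degree.\<close>

definition total_degree :: "('x, 'a::zero) mpoly \<Rightarrow> nat" where
  "total_degree p = Max (insert 0 (monom_degree ` Poly_Mapping.keys p))"

definition eval_mpoly :: "('x \<Rightarrow> 'a::comm_semiring_1) \<Rightarrow> ('x, 'a) mpoly \<Rightarrow> 'a" where
  "eval_mpoly \<alpha> p =
    (\<Sum>m\<in>Poly_Mapping.keys p. Poly_Mapping.lookup p m *
       (\<Prod>i\<in>Poly_Mapping.keys m. \<alpha> i ^ Poly_Mapping.lookup m i))"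

text \<open>
  In a polynomial \<open>p(x, y)\<close> in two groups of \<open>n\<close> variables, \<open>x\<^sub>i\<close> is the variable \<open>Inl i\<close> and
  \<open>y\<^sub>i\<close> is the variable \<open>Inr i\<close>, where \<open>i < n\<close>.
\<close>

definition two_sets_of_vars :: "nat \<Rightarrow> (nat + nat) set" where
  "two_sets_of_vars n = Inl ` {..<n} \<union> Inr ` {..<n}"

text \<open>
  Coordinates of \<open>v\<close> with respect to the basis \<open>Basis\<close> enumerated by \<open>e 0, \<dots>, e (n - 1)\<close>.
\<close>

definition coords ::
    "('a::field \<Rightarrow> 'v::ab_group_add \<Rightarrow> 'v) \<Rightarrow> 'v set \<Rightarrow> (nat \<Rightarrow> 'v) \<Rightarrow> 'v \<Rightarrow> nat \<Rightarrow> 'a" where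
  "coords scale Basis e v i = module.representation scale Basis v (e i)"

text \<open>
  The space of all functions \<open>'v \<Rightarrow> 'a\<close> with pointwise operations. The space of functions on a
  subset \<open>A\<close> is represented by its subspace of functions vanishing outside \<open>A\<close>.
\<close>

definition fun_scale :: "'a::field \<Rightarrow> ('v \<Rightarrow> 'a) \<Rightarrow> 'v \<Rightarrow> 'a" where
  "fun_scale c f = (\<lambda>v. c * f v)"

interpretation fun_vs: vector_space "fun_scale :: 'a::field \<Rightarrow> ('v \<Rightarrow> 'a) \<Rightarrow> 'v \<Rightarrow> 'a"
  by unfold_locales (auto simp: fun_scale_def fun_eq_iff algebra_simps)

definition funs_on :: "'v set \<Rightarrow> ('v \<Rightarrow> 'a::zero) set" where
  "funs_on A = {f. \<forall>v. v \<notin> A \<longrightarrow> f v = 0}"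

definition restrict_fun :: "'v set \<Rightarrow> ('v \<Rightarrow> 'a::zero) \<Rightarrow> 'v \<Rightarrow> 'a" where
  "restrict_fun A f = (\<lambda>v. if v \<in> A then f v else 0)"

text \<open>
  In the following definitions \<open>x v i\<close> is the \<open>i\<close>-th coordinate of \<open>v\<close>.
\<close>

definition dim_polys_on ::
    "('v \<Rightarrow> nat \<Rightarrow> 'a::field) \<Rightarrow> nat \<Rightarrow> nat \<Rightarrow> 'v set \<Rightarrow> nat" where
  "dim_polys_on x n s A =
    fun_vs.dim {restrict_fun A (\<lambda>a. eval_mpoly (x a) q) | q.
                  q \<in> polys_in {..<n} \<and> total_degree q \<le> s}"

definition poly_matrix ::
    "('v \<Rightarrow> nat \<Rightarrow> 'a::comm_semiring_1) \<Rightarrow> (nat + nat, 'a) mpoly \<Rightarrow> 'v \<Rightarrow> 'v \<Rightarrow> 'a" where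
  "poly_matrix x p a b = eval_mpoly (case_sum (x a) (x b)) p"

text \<open>Rank of an \<open>A \<times> A\<close> matrix: the dimension of the space spanned by its columns.\<close>

definition rank_on :: "'v set \<Rightarrow> ('v \<Rightarrow> 'v \<Rightarrow> 'a::field) \<Rightarrow> nat" where
  "rank_on A M = fun_vs.dim ((\<lambda>b. restrict_fun A (\<lambda>a. M a b)) ` A)"

definition bilinear_form ::
    "'v set \<Rightarrow> ('v \<Rightarrow> 'v \<Rightarrow> 'a::comm_semiring_0) \<Rightarrow> ('v \<Rightarrow> 'a) \<Rightarrow> ('v \<Rightarrow> 'a) \<Rightarrow> 'a" where
  "bilinear_form A M f g = (\<Sum>a\<in>A. \<Sum>b\<in>A. M a b * f a * g b)"

definition quadratic_form ::
    "'v set \<Rightarrow> ('v \<Rightarrow> 'v \<Rightarrow> 'a::comm_semiring_0) \<Rightarrow> ('v \<Rightarrow> 'a) \<Rightarrow> 'a" where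
  "quadratic_form A M f = bilinear_form A M f f"

text \<open>
  \<open>B\<close> is a basis of the space of functions on \<open>A\<close> in whose coordinates \<open>c\<close> the form \<open>Q\<close> is
  diagonal. The coefficient of \<open>(c b)\<^sup>2\<close> in such a diagonal form is necessarily \<open>Q b\<close>.
\<close>

definition diagonalizing_basis ::
    "'v set \<Rightarrow> (('v \<Rightarrow> real) \<Rightarrow> real) \<Rightarrow> ('v \<Rightarrow> real) set \<Rightarrow> bool" where
  "diagonalizing_basis A Q B \<longleftrightarrow>
    fun_vs.independent B \<and> fun_vs.span B = funs_on A \<and>
    (\<forall>c. Q (\<Sum>b\<in>B. fun_scale (c b) b) = (\<Sum>b\<in>B. Q b * (c b)\<^sup>2))"

text \<open>
  For a quadratic form on the functions on a finite set \<open>A\<close>, the numbers below exist and are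
  unique by Sylvester's Law of Inertia.
\<close>

definition pos_inertia_index :: "'v set \<Rightarrow> (('v \<Rightarrow> real) \<Rightarrow> real) \<Rightarrow> nat" where
  "pos_inertia_index A Q = (THE r. \<exists>B. diagonalizing_basis A Q B \<and> r = card {b \<in> B. Q b > 0})"

definition neg_inertia_index :: "'v set \<Rightarrow> (('v \<Rightarrow> real) \<Rightarrow> real) \<Rightarrow> nat" where
  "neg_inertia_index A Q = (THE r. \<exists>B. diagonalizing_basis A Q B \<and> r = card {b \<in> B. Q b < 0})"

end

theory Submission
  imports Defs
begin

text \<open>
  A monomial of degree at most \<open>2 * s + 1\<close> in \<open>(x, y)\<close> has degree at most \<open>s\<close> in \<open>x\<close> or in \<open>y\<close>.
  Hence the matrix is \<open>M\<^sub>1 + M\<^sub>2\<close>, where the columns of \<open>M\<^sub>1\<close> and the rows of \<open>M\<^sub>2\<close> lie in the space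
  \<open>U\<close> of polynomial functions of degree at most \<open>s\<close> on \<open>A\<close>; both summands have rank at most \<open>dim U\<close>.
  The quadratic form vanishes on the annihilator of \<open>U\<close>, which is cut out by \<open>dim U\<close> linear equations
  and so meets every subspace of larger dimension nontrivially; in particular a subspace on which the
  form is definite has dimension at most \<open>dim U\<close>.
\<close>

section \<open>Linear algebra\<close>

text \<open>Gaussian elimination, one equation per induction step: an equation that is zero on
  \<open>S\<close> is dropped, any other one is used to eliminate one unknown.\<close>

lemma homogeneous_system_nontrivial_solution:
  fixes l :: "'i \<Rightarrow> 'b \<Rightarrow> 'a::field"
  assumes "finite I" "finite S" "card I < card S"
  shows "\<exists>c. (\<exists>b\<in>S. c b \<noteq> 0) \<and> (\<forall>b. b \<notin> S \<longrightarrow> c b = 0) \<and> (\<forall>i\<in>I. (\<Sum>b\<in>S. c b * l i b) = 0)"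
  using assms
proof (induction I arbitrary: S l rule: finite_induct)
  case empty
  then obtain b where "b \<in> S"
    by fastforce
  then show ?case
    by (intro exI[of _ "\<lambda>x. if x = b then 1 else 0"]) auto
next
  case (insert i I)
  show ?case
  proof (cases "\<forall>b\<in>S. l i b = 0")
    case True
    have "card I < card S"
      using insert by simp
    from insert.IH[OF insert.prems(1) this, of l] show ?thesis
      using True by auto
  next
    case False
    then obtain b0 where b0: "b0 \<in> S" "l i b0 \<noteq> 0"
      by blast
    let ?S = "S - {b0}"
    have "card I < card ?S"
      using insert b0 by simp
    \<comment> \<open>These are the coefficients of equation \<open>j\<close> after the unknown
      \<open>b0\<close> has been eliminated with the help of equation \<open>i\<close>.\<close>
    from insert.IH[OF _ this, of "\<lambda>j b. l j b - l j b0 * l i b / l i b0"] insert.prems(1)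
    obtain c where c: "\<exists>b\<in>?S. c b \<noteq> 0" "\<forall>b. b \<notin> ?S \<longrightarrow> c b = 0"
      "\<forall>j\<in>I. (\<Sum>b\<in>?S. c b * (l j b - l j b0 * l i b / l i b0)) = 0"
      by blast
    \<comment> \<open>Equation \<open>i\<close>, solved for the unknown \<open>b0\<close>.\<close>
    define t where "t = - (\<Sum>b\<in>?S. c b * l i b) / l i b0"
    define d where "d = c(b0 := t)"
    have sum_d: "(\<Sum>b\<in>S. d b * l j b) = t * l j b0 + (\<Sum>b\<in>?S. c b * l j b)" for j
      unfolding d_def using insert.prems(1) b0 by (subst sum.remove[of S b0]) auto
    have "(\<Sum>b\<in>S. d b * l j b) = 0" if "j \<in> insert i I" for j
    proof (cases "j = i")
      case True
      then show ?thesis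
        unfolding sum_d t_def using b0 by simp
    next
      case False
      then have "j \<in> I"
        using that by simp
      have "(\<Sum>b\<in>?S. c b * (l j b - l j b0 * l i b / l i b0)) =
          (\<Sum>b\<in>?S. c b * l j b) - (\<Sum>b\<in>?S. c b * l i b) * (l j b0 / l i b0)"
        unfolding sum_distrib_right sum_subtractf[symmetric]
        by (rule sum.cong) (auto simp: algebra_simps)
      then show ?thesis
        using c(3) \<open>j \<in> I\<close> unfolding sum_d t_def by simp
    qed
    moreover have "\<exists>b\<in>S. d b \<noteq> 0" "\<forall>b. b \<notin> S \<longrightarrow> d b = 0"
      using c(1,2) b0 by (auto simp: d_def)
    ultimately show ?thesis
      by blast
  qed
qed

text \<open>Split off a vector \<open>v\<close> with \<beta> v v nonzero and continue in its
  orthogonal complement; if there is no such vector, \<beta> vanishes on \<open>V\<close> and every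
  basis will do. The finite set \<open>C\<close> need not lie in \<open>V\<close>; its size bounds
  the dimension and is the induction measure.\<close>

lemma (in vector_space) orthogonal_basis_exists:
  fixes \<beta> :: "'b \<Rightarrow> 'b \<Rightarrow> 'a"
  assumes two: "(2::'a) \<noteq> 0"
    and add: "\<And>u v w. \<beta> (u + v) w = \<beta> u w + \<beta> v w"
    and scl: "\<And>c v w. \<beta> (scale c v) w = c * \<beta> v w"
    and sym: "\<And>v w. \<beta> v w = \<beta> w v"
    and "subspace V" "finite C" "V \<subseteq> span C"
  shows "\<exists>B. independent B \<and> span B = V \<and> (\<forall>b\<in>B. \<forall>b'\<in>B. b \<noteq> b' \<longrightarrow> \<beta> b b' = 0)"
  using assms(5-)
proof (induction "card C" arbitrary: V C rule: less_induct)
  case less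
  obtain D where D: "D \<subseteq> V" "independent D" "V \<subseteq> span D"
    by (rule basis_exists)
  have span_D: "span D = V"
    using D less.prems(1) span_subspace by blast
  have finite_D: "finite D" "card D \<le> card C"
    using independent_span_bound[OF less.prems(2) D(2)] D(1) less.prems(3) by auto
  show ?case
  proof (cases "\<forall>v\<in>V. \<beta> v v = 0")
    case True
    \<comment> \<open>Polarization; this is where 2 must be invertible.\<close>
    have "\<beta> v w = 0" if "v \<in> V" "w \<in> V" for v w
    proof -
      have "v + w \<in> V"
        using that less.prems(1) subspace_add by blast
      then have "\<beta> (v + w) (v + w) = 0"
        using True by blast
      moreover have "\<beta> (v + w) (v + w) = \<beta> (v + w) v + \<beta> (v + w) w"
        by (simp only: add[of v w "v + w"] sym[of v "v + w"] sym[of w "v + w"])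
      then have "\<beta> (v + w) (v + w) = \<beta> v v + \<beta> w w + 2 * \<beta> v w"
        by (simp add: add sym[of w v])
      ultimately show ?thesis
        using True that two by simp
    qed
    then show ?thesis
      using D(1,2) span_D by blast
  next
    case False
    then obtain v where v: "v \<in> V" "\<beta> v v \<noteq> 0"
      by blast
    define W where "W = {w \<in> V. \<beta> w v = 0}"
    have \<beta>0: "\<beta> 0 v = 0"
      using scl[of 0 0 v] by simp
    have sub_W: "subspace W"
      using less.prems(1) \<beta>0 by (auto simp: W_def subspace_def add scl)
    obtain E where E: "E \<subseteq> W" "independent E" "W \<subseteq> span E"
      by (rule basis_exists)
    have span_E: "span E = W"
      using E sub_W span_subspace by blast
    have v_notin: "v \<notin> span E"
      using v(2) by (simp add: span_E W_def)
    \<comment> \<open>As \<open>v\<close> lies outside \<open>W\<close>, adding it to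
      \<open>E\<close> keeps independence inside \<open>V\<close>. So \<open>E\<close> is strictly
      smaller than \<open>C\<close> and can serve as the spanning set for \<open>W\<close> in the
      induction.\<close>
    have "insert v E \<subseteq> span D"
      using E(1) v(1) span_D by (auto simp: W_def)
    then have "finite (insert v E)" "card (insert v E) \<le> card D"
      using independent_span_bound[OF finite_D(1) independent_insertI[OF v_notin E(2)]] by auto
    moreover have "v \<notin> E"
      using v_notin span_base by blast
    ultimately have fin_E: "finite E" and "card E < card C"
      using finite_D(2) by auto
    from less.hyps[OF this(2) sub_W fin_E E(3)]
    obtain B where B: "independent B" "span B = W" "\<forall>b\<in>B. \<forall>b'\<in>B. b \<noteq> b' \<longrightarrow> \<beta> b b' = 0"
      by blast
    have "independent (insert v B)"
      using independent_insertI B v_notin span_E by simp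
    moreover have "span (insert v B) = V"
    proof
      have "B \<subseteq> V"
        using B(2) span_superset[of B] by (auto simp: W_def)
      then show "span (insert v B) \<subseteq> V"
        using v(1) less.prems(1) by (intro span_minimal) auto
      show "V \<subseteq> span (insert v B)"
      proof
        fix u
        assume u: "u \<in> V"
        \<comment> \<open>The projection coefficient of \<open>u\<close> along \<open>v\<close>: the
          difference below is orthogonal to \<open>v\<close> and thus lies in
          \<open>W\<close>.\<close>
        let ?k = "\<beta> u v / \<beta> v v"
        have "u - scale ?k v \<in> V"
          using u v(1) less.prems(1) subspace_diff subspace_scale by blast
        moreover have "\<beta> (u - scale ?k v) v = 0"
          using add[of "u - scale ?k v" "scale ?k v" v] scl v(2) by simp
        ultimately show "u \<in> span (insert v B)"
          unfolding span_breakdown_eq B(2) W_def by (intro exI[of _ ?k]) simp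
      qed
    qed
    moreover have "\<beta> b v = 0" "\<beta> v b = 0" if "b \<in> B" for b
      using that B(2) span_superset[of B] sym[of b v] by (auto simp: W_def)
    ultimately show ?thesis
      using B(3) by (intro exI[of _ "insert v B"]) auto
  qed
qed

section \<open>Functions on a finite set\<close>

lemma sum_fun_apply: "(\<Sum>i\<in>I. f i) x = (\<Sum>i\<in>I. f i x)"
  by (induction I rule: infinite_finite_induct) auto

lemma subspace_funs_on: "fun_vs.subspace (funs_on A)"
  by (auto simp: fun_vs.subspace_def funs_on_def fun_scale_def)

lemma restrict_fun_in_funs_on: "restrict_fun A f \<in> funs_on A"
  by (simp add: restrict_fun_def funs_on_def)

lemma funs_on_finite_spanning_set:
  assumes "finite A"
  shows "\<exists>C. finite C \<and> (funs_on A :: ('v \<Rightarrow> 'a::field) set) \<subseteq> fun_vs.span C"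
proof -
  define \<delta> :: "'v \<Rightarrow> 'v \<Rightarrow> 'a" where "\<delta> a v = (if v = a then 1 else 0)" for a v
  have "f \<in> fun_vs.span (\<delta> ` A)" if "f \<in> funs_on A" for f
  proof -
    have "f = (\<Sum>a\<in>A. fun_scale (f a) (\<delta> a))"
      using that assms
      by (auto simp: fun_eq_iff sum_fun_apply fun_scale_def \<delta>_def funs_on_def if_distrib cong: if_cong)
    also have "\<dots> \<in> fun_vs.span (\<delta> ` A)"
      by (intro fun_vs.span_sum fun_vs.span_scale fun_vs.span_base) auto
    finally show ?thesis .
  qed
  then show ?thesis
    using assms by blast
qed

text \<open>The ambient space of all functions may be infinite-dimensional, so finiteness of bases
  has to come from \<open>A\<close>.\<close>

lemma finite_independent_funs_on:
  assumes "finite A" "fun_vs.independent B" "B \<subseteq> funs_on A"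
  shows "finite B"
proof -
  obtain C where C: "finite C" "(funs_on A :: ('a \<Rightarrow> 'b) set) \<subseteq> fun_vs.span C"
    using funs_on_finite_spanning_set[OF assms(1)] by blast
  then show ?thesis
    using fun_vs.independent_span_bound[OF C(1) assms(2)] assms(3) by blast
qed

lemma finite_basis_of_funs_on_subset:
  fixes S :: "('v \<Rightarrow> 'a::field) set"
  assumes "finite A" "S \<subseteq> funs_on A"
  obtains B where "B \<subseteq> S" "fun_vs.independent B" "fun_vs.span B = fun_vs.span S"
    "finite B" "card B = fun_vs.dim S"
proof -
  obtain B where B: "B \<subseteq> S" "fun_vs.independent B" "S \<subseteq> fun_vs.span B" "card B = fun_vs.dim S"
    by (rule fun_vs.basis_exists)
  moreover have "fun_vs.span B = fun_vs.span S"
    using fun_vs.span_mono[OF B(1)] fun_vs.span_minimal[OF B(3) fun_vs.subspace_span] by (rule equalityI)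
  moreover have "finite B"
    using finite_independent_funs_on[OF assms(1) B(2)] B(1) assms(2) by blast
  ultimately show ?thesis
    using that by blast
qed

section \<open>Inertia indices\<close>

lemma diagonalizing_basisD:
  assumes "diagonalizing_basis A Q B"
  shows "fun_vs.independent B" "fun_vs.span B = funs_on A" "B \<subseteq> funs_on A"
    "Q (\<Sum>b\<in>B. fun_scale (c b) b) = (\<Sum>b\<in>B. Q b * (c b)\<^sup>2)"
  using assms fun_vs.span_superset[of B] unfolding diagonalizing_basis_def by auto

lemma finite_diagonalizing_basis:
  assumes "finite A" "diagonalizing_basis A Q B"
  shows "finite B"
  using finite_independent_funs_on[OF assms(1)] diagonalizing_basisD[OF assms(2)] by blast

text \<open>
  Applied to two diagonalizing bases, this is Sylvester's Law of Inertia; applied to the annihilator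
  of the space of polynomial functions, it is the bound on the inertia indices.
\<close>

lemma card_positive_le_codim_nonpositive:
  fixes Q :: "('v \<Rightarrow> real) \<Rightarrow> real" and l :: "'i \<Rightarrow> ('v \<Rightarrow> real) \<Rightarrow> real"
  assumes "finite A" "diagonalizing_basis A Q B" "finite I"
    and nonpos: "\<And>c. (\<And>i. i \<in> I \<Longrightarrow> (\<Sum>b\<in>B. c b * l i b) = 0) \<Longrightarrow>
      Q (\<Sum>b\<in>B. fun_scale (c b) b) \<le> 0"
  shows "card {b \<in> B. Q b > 0} \<le> card I"
proof (rule ccontr)
  let ?P = "{b \<in> B. Q b > 0}"
  have fin_B: "finite B"
    using finite_diagonalizing_basis assms(1,2) .
  assume "\<not> card ?P \<le> card I"
  \<comment> \<open>There are more positive basis vectors than conditions, so some nonzero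
    combination of positive basis vectors satisfies all conditions. The diagonal form makes
    \<open>Q\<close> strictly positive there, against \<open>nonpos\<close>.\<close>
  then obtain c where c: "\<exists>b\<in>?P. c b \<noteq> 0" "\<forall>b. b \<notin> ?P \<longrightarrow> c b = 0"
      "\<forall>i\<in>I. (\<Sum>b\<in>?P. c b * l i b) = 0"
    using homogeneous_system_nontrivial_solution[of I ?P l] assms(3) fin_B by auto
  have "(\<Sum>b\<in>B. c b * l i b) = (\<Sum>b\<in>?P. c b * l i b)" for i
    using fin_B c(2) by (intro sum.mono_neutral_right) auto
  then have "Q (\<Sum>b\<in>B. fun_scale (c b) b) \<le> 0"
    using nonpos c(3) by simp
  moreover obtain b where b: "b \<in> ?P" "c b \<noteq> 0"
    using c(1) by blast
  have "(\<Sum>b\<in>B. Q b * (c b)\<^sup>2) > 0"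
  proof (rule sum_pos2[OF fin_B])
    show "0 \<le> Q b * (c b)\<^sup>2" if "b \<in> B" for b
      using c(2) that by (cases "b \<in> ?P") auto
  qed (use b in auto)
  ultimately show False
    using diagonalizing_basisD(4)[OF assms(2)] by simp
qed

text \<open>The conditions imposed are that the coordinates at the positive vectors of
  \<open>B'\<close> vanish; the diagonal form in \<open>B'\<close> then has only nonpositive terms
  left. Exchanging \<open>B\<close> and \<open>B'\<close> gives equality.\<close>

lemma card_positive_le:
  assumes "finite A" "diagonalizing_basis A Q B" "diagonalizing_basis A Q B'"
  shows "card {b \<in> B. Q b > 0} \<le> card {b \<in> B'. Q b > 0}"
proof (rule card_positive_le_codim_nonpositive[OF assms(1,2)])
  note fin = finite_diagonalizing_basis[OF assms(1,3)]
  note B' = diagonalizing_basisD[OF assms(3)]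
  let ?r = "fun_vs.representation B'"
  show "finite {b \<in> B'. Q b > 0}"
    using fin by simp
  fix c
  assume zero: "(\<Sum>b\<in>B. c b * ?r b i) = 0" if "i \<in> {b \<in> B'. Q b > 0}" for i
  \<comment> \<open>Change of basis: the coordinate at \<open>i\<close> in \<open>B'\<close> is
    linear in the unknowns \<open>c\<close>.\<close>
  have "(\<Sum>b\<in>B. fun_scale (c b) b) = (\<Sum>b\<in>B. fun_scale (c b) (\<Sum>i\<in>B'. fun_scale (?r b i) i))"
    using diagonalizing_basisD(3)[OF assms(2)] B' fin
    by (intro sum.cong refl arg_cong[of _ _ "fun_scale _"])
      (auto simp: fun_vs.sum_representation_eq)
  also have "\<dots> = (\<Sum>i\<in>B'. fun_scale (\<Sum>b\<in>B. c b * ?r b i) i)"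
    unfolding fun_vs.scale_sum_right fun_vs.scale_sum_left fun_vs.scale_scale by (rule sum.swap)
  finally have "Q (\<Sum>b\<in>B. fun_scale (c b) b) = (\<Sum>i\<in>B'. Q i * (\<Sum>b\<in>B. c b * ?r b i)\<^sup>2)"
    using B'(4) by simp
  also have "\<dots> \<le> 0"
  proof (rule sum_nonpos)
    fix i
    assume "i \<in> B'"
    then show "Q i * (\<Sum>b\<in>B. c b * ?r b i)\<^sup>2 \<le> 0"
      using zero[of i] by (cases "Q i > 0") (auto simp: mult_le_0_iff)
  qed
  finally show "Q (\<Sum>b\<in>B. fun_scale (c b) b) \<le> 0" .
qed

lemma diagonalizing_basis_exists:
  fixes M :: "'v \<Rightarrow> 'v \<Rightarrow> real"
  assumes "finite A"
  shows "\<exists>B. diagonalizing_basis A (quadratic_form A M) B"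
proof -
  \<comment> \<open>\<open>M\<close> need not be symmetric; its symmetrization has the same
    quadratic form, and over the reals an orthogonal basis for it exists.\<close>
  define \<beta> where "\<beta> f g = bilinear_form A M f g / 2 + bilinear_form A M g f / 2" for f g
  have Q: "quadratic_form A M f = \<beta> f f" for f
    by (simp add: \<beta>_def quadratic_form_def)
  have add: "\<beta> (f + g) h = \<beta> f h + \<beta> g h" for f g h
    by (simp add: \<beta>_def bilinear_form_def sum.distrib algebra_simps add_divide_distrib)
  have scl: "\<beta> (fun_scale c g) h = c * \<beta> g h" for c g h
    by (simp add: \<beta>_def bilinear_form_def fun_scale_def sum_distrib_left algebra_simps)
  have sym: "\<beta> f g = \<beta> g f" for f g
    by (simp add: \<beta>_def)
  have zero: "\<beta> 0 h = 0" for h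
    by (simp add: \<beta>_def bilinear_form_def)
  have sum_l: "\<beta> (\<Sum>i\<in>I. fun_scale (c i) (f i)) h = (\<Sum>i\<in>I. c i * \<beta> (f i) h)"
    for I c f h
    by (induction I rule: infinite_finite_induct)
      (simp_all only: sum.infinite sum.empty sum.insert add scl zero not_False_eq_True)
  obtain C where C: "finite C" "(funs_on A :: ('v \<Rightarrow> real) set) \<subseteq> fun_vs.span C"
    using funs_on_finite_spanning_set[OF assms] by blast
  obtain B where B: "fun_vs.independent B" "fun_vs.span B = funs_on A"
    "\<forall>b\<in>B. \<forall>b'\<in>B. b \<noteq> b' \<longrightarrow> \<beta> b b' = 0"
    using fun_vs.orthogonal_basis_exists[of \<beta>, OF _ add scl sym subspace_funs_on C] by auto
  have fin: "finite B"
    using finite_independent_funs_on[OF assms B(1)] B(2) fun_vs.span_superset by blast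
  have "\<beta> (\<Sum>b\<in>B. fun_scale (c b) b) (\<Sum>b\<in>B. fun_scale (c b) b) = (\<Sum>b\<in>B. \<beta> b b * (c b)\<^sup>2)" for c
  proof -
    have "\<beta> (\<Sum>b\<in>B. fun_scale (c b) b) b = c b * \<beta> b b" if "b \<in> B" for b
      unfolding sum_l using fin that B(3) by (subst sum.remove[of B b]) auto
    then show ?thesis
      by (subst sum_l) (auto simp: sym[of _ "sum _ _"] power2_eq_square intro!: sum.cong)
  qed
  then show ?thesis
    using B(1,2) unfolding diagonalizing_basis_def Q by blast
qed

text \<open>Two applications of \<open>card_positive_le\<close> give the uniqueness behind
  \<open>THE\<close>; afterwards the index can be read off from any diagonalizing basis.\<close>

lemma pos_inertia_index_eq:
  assumes "finite A" "diagonalizing_basis A Q B"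
  shows "pos_inertia_index A Q = card {b \<in> B. Q b > 0}"
  unfolding pos_inertia_index_def
proof (rule the_equality)
  fix r
  assume "\<exists>B. diagonalizing_basis A Q B \<and> r = card {b \<in> B. Q b > 0}"
  then obtain B' where "diagonalizing_basis A Q B'" "r = card {b \<in> B'. Q b > 0}"
    by blast
  then show "r = card {b \<in> B. Q b > 0}"
    using card_positive_le[OF assms(1,2)] card_positive_le[OF assms(1) _ assms(2)]
    by (simp add: le_antisym)
qed (use assms(2) in blast)

text \<open>Negating the form keeps its diagonalizing bases and flips all signs, so bounds need
  proof for positive indices only.\<close>

lemma neg_inertia_index_eq_pos:
  "neg_inertia_index A Q = pos_inertia_index A (\<lambda>f. - Q f)"
proof -
  have "diagonalizing_basis A (\<lambda>f. - Q f) B \<longleftrightarrow> diagonalizing_basis A Q B" for B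
    by (simp add: diagonalizing_basis_def sum_negf)
  then show ?thesis
    by (simp add: pos_inertia_index_def neg_inertia_index_def)
qed

text \<open>Being orthogonal to \<open>span S\<close> amounts to orthogonality to each member of a
  basis of it, which is \<open>dim S\<close> linear conditions; the count of positive basis vectors
  cannot exceed that.\<close>

lemma pos_inertia_index_le_dim:
  fixes M :: "'v \<Rightarrow> 'v \<Rightarrow> real"
  assumes "finite A" "S \<subseteq> funs_on A"
    and zero: "\<And>f. (\<And>u. u \<in> fun_vs.span S \<Longrightarrow> (\<Sum>a\<in>A. u a * f a) = 0) \<Longrightarrow> quadratic_form A M f \<le> 0"
  shows "pos_inertia_index A (quadratic_form A M) \<le> fun_vs.dim S"
proof -
  obtain U where U: "U \<subseteq> S" "fun_vs.span U = fun_vs.span S" "finite U" "card U = fun_vs.dim S"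
    using finite_basis_of_funs_on_subset[OF assms(1,2)] by metis
  obtain B where B: "diagonalizing_basis A (quadratic_form A M) B"
    using diagonalizing_basis_exists[OF assms(1)] by blast
  have "card {b \<in> B. quadratic_form A M b > 0} \<le> card U"
  proof (rule card_positive_le_codim_nonpositive[OF assms(1) B U(3)])
    fix c
    assume c: "(\<Sum>b\<in>B. c b * (\<Sum>a\<in>A. u a * b a)) = 0" if "u \<in> U" for u
    let ?f = "\<Sum>b\<in>B. fun_scale (c b) b"
    show "quadratic_form A M ?f \<le> 0"
    proof (rule zero)
      fix u
      assume "u \<in> fun_vs.span S"
      then have "u \<in> fun_vs.span U"
        using U(2) by simp
      \<comment> \<open>The conditions on \<open>c\<close> say that ?f is orthogonal to the members
        of \<open>U\<close>; linearity extends this to the span.\<close>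
      then show "(\<Sum>a\<in>A. u a * ?f a) = 0"
      proof (induction rule: fun_vs.span_induct_alt)
        case base
        show ?case by simp
      next
        case (step k x y)
        have "(\<Sum>a\<in>A. x a * ?f a) = (\<Sum>a\<in>A. \<Sum>b\<in>B. c b * (x a * b a))"
          by (simp add: sum_fun_apply fun_scale_def sum_distrib_left algebra_simps)
        also have "\<dots> = (\<Sum>b\<in>B. c b * (\<Sum>a\<in>A. x a * b a))"
          unfolding sum_distrib_left by (rule sum.swap)
        finally have x: "(\<Sum>a\<in>A. x a * ?f a) = 0"
          using c[OF step(1)] by simp
        have "(\<Sum>a\<in>A. (fun_scale k x + y) a * ?f a) = k * (\<Sum>a\<in>A. x a * ?f a) + (\<Sum>a\<in>A. y a * ?f a)"
          by (simp add: fun_scale_def sum_distrib_left sum.distrib algebra_simps)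
        then show ?case
          using x step by simp
      qed
    qed
  qed
  then show ?thesis
    using pos_inertia_index_eq[OF assms(1) B] U(4) by simp
qed

section \<open>Sums of products with one factor in a given space\<close>

lemma rank_on_le_twice_dim:
  fixes M :: "'v \<Rightarrow> 'v \<Rightarrow> 'a::field"
  assumes "finite A" "S \<subseteq> funs_on A" "finite K"
    and M: "\<And>a b. M a b = (\<Sum>m\<in>K. c m * \<phi> m a * \<psi> m b)"
    and factor: "\<And>m. m \<in> K \<Longrightarrow>
      restrict_fun A (\<phi> m) \<in> fun_vs.span S \<or> restrict_fun A (\<psi> m) \<in> fun_vs.span S"
  shows "rank_on A M \<le> 2 * fun_vs.dim S"
proof -
  obtain U where U: "fun_vs.independent U" "fun_vs.span U = fun_vs.span S" "finite U"
      "card U = fun_vs.dim S"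
    using finite_basis_of_funs_on_subset[OF assms(1,2)] by metis
  define K1 where "K1 = {m \<in> K. restrict_fun A (\<phi> m) \<in> fun_vs.span S}"
  define r where "r m = fun_vs.representation U (restrict_fun A (\<psi> m))" for m
  \<comment> \<open>The function of \<open>a\<close> that multiplies \<open>u b\<close> once each
    right factor has been expanded in \<open>U\<close> and the terms collected.\<close>
  define G where "G u = (\<Sum>m\<in>K - K1. fun_scale (c m * r m u) (restrict_fun A (\<phi> m)))" for u
  have \<psi>: "\<psi> m b = (\<Sum>u\<in>U. r m u * u b)" if "m \<in> K - K1" "b \<in> A" for m b
  proof -
    have "restrict_fun A (\<psi> m) \<in> fun_vs.span U"
      using factor that U(2) unfolding K1_def by blast
    then have "(\<Sum>u\<in>U. fun_scale (r m u) u) = restrict_fun A (\<psi> m)"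
      unfolding r_def using U(1,3) by (intro fun_vs.sum_representation_eq) auto
    from fun_cong[OF this, of b] show ?thesis
      using that(2) by (simp add: sum_fun_apply fun_scale_def restrict_fun_def)
  qed
  have "restrict_fun A (\<lambda>a. M a b) \<in> fun_vs.span (U \<union> G ` U)" if b: "b \<in> A" for b
  proof -
    have "restrict_fun A (\<lambda>a. M a b) =
        (\<Sum>m\<in>K1. fun_scale (c m * \<psi> m b) (restrict_fun A (\<phi> m))) + (\<Sum>u\<in>U. fun_scale (u b) (G u))"
      (is "_ = ?F1 + ?F2")
    proof
      fix a
      have "?F2 a = (\<Sum>u\<in>U. \<Sum>m\<in>K - K1. u b * (c m * r m u * restrict_fun A (\<phi> m) a))"
        by (simp add: sum_fun_apply fun_scale_def G_def sum_distrib_left)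
      also have "\<dots> = (\<Sum>m\<in>K - K1. \<Sum>u\<in>U. u b * (c m * r m u * restrict_fun A (\<phi> m) a))"
        by (rule sum.swap)
      also have "\<dots> = (\<Sum>m\<in>K - K1. c m * restrict_fun A (\<phi> m) a * \<psi> m b)"
        by (rule sum.cong) (auto simp: \<psi>[OF _ b] sum_distrib_left algebra_simps)
      finally have F2: "?F2 a = (\<Sum>m\<in>K - K1. c m * restrict_fun A (\<phi> m) a * \<psi> m b)" .
      have F1: "?F1 a = (\<Sum>m\<in>K1. c m * restrict_fun A (\<phi> m) a * \<psi> m b)"
        by (simp add: sum_fun_apply fun_scale_def algebra_simps)
      have "restrict_fun A (\<lambda>a. M a b) a = (\<Sum>m\<in>K. c m * restrict_fun A (\<phi> m) a * \<psi> m b)"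
        by (simp add: M restrict_fun_def)
      also have "\<dots> = ?F1 a + ?F2 a"
        unfolding F1 F2 using \<open>finite K\<close>
        by (subst sum.subset_diff[of K1 K]) (auto simp: K1_def)
      finally show "restrict_fun A (\<lambda>a. M a b) a = (?F1 + ?F2) a"
        by simp
    qed
    moreover have "?F1 \<in> fun_vs.span U"
      unfolding U(2) by (intro fun_vs.span_sum fun_vs.span_scale) (auto simp: K1_def)
    then have "?F1 \<in> fun_vs.span (U \<union> G ` U)"
      using fun_vs.span_mono[of U "U \<union> G ` U"] by blast
    moreover have "?F2 \<in> fun_vs.span (U \<union> G ` U)"
      by (intro fun_vs.span_sum fun_vs.span_scale fun_vs.span_base) auto
    ultimately show ?thesis
      by (simp only: fun_vs.span_add)
  qed
  then have "rank_on A M \<le> card (U \<union> G ` U)"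
    unfolding rank_on_def using U(3) by (intro fun_vs.dim_le_card) auto
  also have "\<dots> \<le> 2 * card U"
    using card_Un_le[of U "G ` U"] card_image_le[OF U(3), of G] by simp
  finally show ?thesis
    using U(4) by simp
qed

text \<open>On the diagonal, each term of \<open>M\<close> yields the product of the pairings of
  \<open>f\<close> with \<phi> m and with \<psi> m, one of which vanishes.\<close>

lemma quadratic_form_eq_0_on_annihilator:
  fixes M :: "'v \<Rightarrow> 'v \<Rightarrow> 'a::field"
  assumes M: "\<And>a b. M a b = (\<Sum>m\<in>K. c m * \<phi> m a * \<psi> m b)"
    and factor: "\<And>m. m \<in> K \<Longrightarrow>
      restrict_fun A (\<phi> m) \<in> fun_vs.span S \<or> restrict_fun A (\<psi> m) \<in> fun_vs.span S"
    and f: "\<And>u. u \<in> fun_vs.span S \<Longrightarrow> (\<Sum>a\<in>A. u a * f a) = 0"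
  shows "quadratic_form A M f = 0"
proof -
  have "quadratic_form A M f = (\<Sum>a\<in>A. \<Sum>b\<in>A. \<Sum>m\<in>K. c m * ((\<phi> m a * f a) * (\<psi> m b * f b)))"
    by (simp add: quadratic_form_def bilinear_form_def M sum_distrib_left sum_distrib_right algebra_simps)
  also have "\<dots> = (\<Sum>a\<in>A. \<Sum>m\<in>K. \<Sum>b\<in>A. c m * ((\<phi> m a * f a) * (\<psi> m b * f b)))"
    by (intro sum.cong refl sum.swap)
  also have "\<dots> = (\<Sum>m\<in>K. \<Sum>a\<in>A. \<Sum>b\<in>A. c m * ((\<phi> m a * f a) * (\<psi> m b * f b)))"
    by (rule sum.swap)
  also have "\<dots> = (\<Sum>m\<in>K. c m * ((\<Sum>a\<in>A. \<phi> m a * f a) * (\<Sum>b\<in>A. \<psi> m b * f b)))"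
    unfolding sum_product by (simp add: sum_distrib_left)
  also have "\<dots> = 0"
  proof (rule sum.neutral, rule ballI)
    fix m
    assume "m \<in> K"
    \<comment> \<open>The pairing sees only values on \<open>A\<close>, so restricting
      \<open>g\<close> to \<open>A\<close> does not change it.\<close>
    moreover have "(\<Sum>a\<in>A. g a * f a) = 0" if "restrict_fun A g \<in> fun_vs.span S" for g
      using f[OF that] by (simp add: restrict_fun_def)
    ultimately show "c m * ((\<Sum>a\<in>A. \<phi> m a * f a) * (\<Sum>b\<in>A. \<psi> m b * f b)) = 0"
      using factor[of m] by auto
  qed
  finally show ?thesis .
qed

section \<open>Splitting monomials\<close>

definition eval_monom :: "('x \<Rightarrow> 'a::comm_semiring_1) \<Rightarrow> ('x \<Rightarrow>\<^sub>0 nat) \<Rightarrow> 'a" where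
  "eval_monom \<alpha> m = (\<Prod>i\<in>Poly_Mapping.keys m. \<alpha> i ^ Poly_Mapping.lookup m i)"

text \<open>Pulling the exponents back along \<open>Inl\<close> keeps exactly the \<open>x\<close>
  variables of a monomial.\<close>

abbreviation left_part :: "('x + 'y \<Rightarrow>\<^sub>0 nat) \<Rightarrow> ('x \<Rightarrow>\<^sub>0 nat)" where
  "left_part \<equiv> Poly_Mapping.map_key Inl"

abbreviation right_part :: "('x + 'y \<Rightarrow>\<^sub>0 nat) \<Rightarrow> ('y \<Rightarrow>\<^sub>0 nat)" where
  "right_part \<equiv> Poly_Mapping.map_key Inr"

text \<open>The union is disjoint; hence the degree becomes a sum over the two parts and the
  evaluation a product.\<close>

lemma keys_eq_Un_parts:
  "Poly_Mapping.keys m = Inl ` Poly_Mapping.keys (left_part m) \<union> Inr ` Poly_Mapping.keys (right_part m)"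
  (is "_ = ?R")
proof -
  have "z \<in> ?R \<longleftrightarrow> z \<in> Poly_Mapping.keys m" for z
    by (cases z) (auto simp: keys_map_key)
  then show ?thesis
    by blast
qed

lemma monom_degree_parts: "monom_degree m = monom_degree (left_part m) + monom_degree (right_part m)"
  unfolding monom_degree_def
  by (subst keys_eq_Un_parts[of m], subst sum.union_disjoint)
    (auto simp: sum.reindex map_key.rep_eq)

lemma eval_monom_parts:
  "eval_monom (case_sum \<alpha> \<beta>) m = eval_monom \<alpha> (left_part m) * eval_monom \<beta> (right_part m)"
  unfolding eval_monom_def
  by (subst keys_eq_Un_parts[of m], subst prod.union_disjoint)
    (auto simp: prod.reindex map_key.rep_eq)

text \<open>This is the sum of products, one for each monomial, that
  \<open>rank_on_le_twice_dim\<close> and \<open>quadratic_form_eq_0_on_annihilator\<close> ask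
  for.\<close>

lemma poly_matrix_eq_sum:
  "poly_matrix x p a b = (\<Sum>m\<in>Poly_Mapping.keys p. Poly_Mapping.lookup p m *
      eval_monom (x a) (left_part m) * eval_monom (x b) (right_part m))"
  by (simp add: poly_matrix_def eval_mpoly_def eval_monom_parts mult.assoc flip: eval_monom_def)

text \<open>A name for the set whose dimension is \<open>dim_polys_on\<close>; working with its span
  avoids proving that it is a subspace.\<close>

definition low_degree_funs :: "('v \<Rightarrow> nat \<Rightarrow> 'a::field) \<Rightarrow> nat \<Rightarrow> nat \<Rightarrow> 'v set \<Rightarrow> ('v \<Rightarrow> 'a) set" where
  "low_degree_funs x n s A = {restrict_fun A (\<lambda>a. eval_mpoly (x a) q) | q.
    q \<in> polys_in {..<n} \<and> total_degree q \<le> s}"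

lemma low_degree_funs_subset: "low_degree_funs x n s A \<subseteq> funs_on A"
  by (auto simp: low_degree_funs_def restrict_fun_in_funs_on)

lemma eval_monom_in_low_degree_funs:
  fixes x :: "'v \<Rightarrow> nat \<Rightarrow> 'a::field"
  assumes "Poly_Mapping.keys k \<subseteq> {..<n}" "monom_degree k \<le> s"
  shows "restrict_fun A (\<lambda>a. eval_monom (x a) k) \<in> low_degree_funs x n s A"
proof -
  let ?q = "Poly_Mapping.single k 1 :: (nat, 'a) mpoly"
  have "eval_mpoly \<alpha> ?q = eval_monom \<alpha> k" for \<alpha>
    by (simp add: eval_mpoly_def eval_monom_def)
  moreover have "?q \<in> polys_in {..<n}" "total_degree ?q \<le> s"
    using assms by (auto simp: polys_in_def total_degree_def)
  ultimately show ?thesis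
    unfolding low_degree_funs_def by (intro CollectI exI[of _ ?q]) simp
qed

text \<open>The degrees of the two parts add up to at most \<open>2 * s + 1\<close>; if both were at
  least \<open>s + 1\<close>, the sum would reach \<open>2 * s + 2\<close>.\<close>

lemma monomial_factor_in_low_degree_funs:
  assumes "p \<in> polys_in (two_sets_of_vars n)" "total_degree p \<le> 2 * s + 1"
    and m: "m \<in> Poly_Mapping.keys p"
  shows "restrict_fun A (\<lambda>a. eval_monom (x a) (left_part m)) \<in> fun_vs.span (low_degree_funs x n s A) \<or>
    restrict_fun A (\<lambda>a. eval_monom (x a) (right_part m)) \<in> fun_vs.span (low_degree_funs x n s A)"
proof -
  have "Poly_Mapping.keys m \<subseteq> two_sets_of_vars n"
    using assms(1) m by (auto simp: polys_in_def)
  then have "Poly_Mapping.keys (left_part m) \<subseteq> {..<n}" "Poly_Mapping.keys (right_part m) \<subseteq> {..<n}"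
    by (auto simp: keys_map_key two_sets_of_vars_def)
  moreover have "monom_degree m \<le> total_degree p"
    unfolding total_degree_def using m by (intro Max_ge) auto
  then have "monom_degree (left_part m) \<le> s \<or> monom_degree (right_part m) \<le> s"
    using assms(2) monom_degree_parts[of m] by linarith
  ultimately show ?thesis
    using eval_monom_in_low_degree_funs[of "left_part m" n s A x]
      eval_monom_in_low_degree_funs[of "right_part m" n s A x]
    by (auto intro: fun_vs.span_base)
qed

lemma rank_on_poly_matrix_le:
  assumes "finite A" "p \<in> polys_in (two_sets_of_vars n)" "total_degree p \<le> 2 * s + 1"
  shows "rank_on A (poly_matrix x p) \<le> 2 * dim_polys_on x n s A"
proof -
  have "rank_on A (poly_matrix x p) \<le> 2 * fun_vs.dim (low_degree_funs x n s A)"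
    by (rule rank_on_le_twice_dim[OF assms(1) low_degree_funs_subset finite_keys])
      (rule poly_matrix_eq_sum, rule monomial_factor_in_low_degree_funs[OF assms(2,3)])
  then show ?thesis
    by (simp add: dim_polys_on_def low_degree_funs_def)
qed

lemma inertia_indices_poly_matrix_le:
  fixes p :: "(nat + nat, real) mpoly"
  assumes "finite A" "p \<in> polys_in (two_sets_of_vars n)" "total_degree p \<le> 2 * s + 1"
  shows "pos_inertia_index A (quadratic_form A (poly_matrix x p)) \<le> dim_polys_on x n s A"
    and "neg_inertia_index A (quadratic_form A (poly_matrix x p)) \<le> dim_polys_on x n s A"
proof -
  let ?S = "low_degree_funs x n s A"
  let ?M = "poly_matrix x p"
  have zero: "quadratic_form A ?M f = 0"
    if "\<And>u. u \<in> fun_vs.span ?S \<Longrightarrow> (\<Sum>a\<in>A. u a * f a) = 0" for f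
    by (rule quadratic_form_eq_0_on_annihilator[where S = ?S and K = "Poly_Mapping.keys p" and
          c = "Poly_Mapping.lookup p" and \<phi> = "\<lambda>m a. eval_monom (x a) (left_part m)" and
          \<psi> = "\<lambda>m b. eval_monom (x b) (right_part m)"])
      (rule poly_matrix_eq_sum, rule monomial_factor_in_low_degree_funs[OF assms(2,3)], assumption, rule that)
  \<comment> \<open>The negated form belongs to the negated matrix and vanishes on the same
    annihilator, so the bound on positive indices covers it.\<close>
  have neg: "(\<lambda>f. - quadratic_form A ?M f) = quadratic_form A (\<lambda>a b. - ?M a b)"
    by (simp add: fun_eq_iff quadratic_form_def bilinear_form_def sum_negf)
  have dim: "dim_polys_on x n s A = fun_vs.dim ?S"
    by (simp add: dim_polys_on_def low_degree_funs_def)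
  show "pos_inertia_index A (quadratic_form A ?M) \<le> dim_polys_on x n s A"
    unfolding dim
    by (rule pos_inertia_index_le_dim[OF assms(1) low_degree_funs_subset]) (simp add: zero)
  show "neg_inertia_index A (quadratic_form A ?M) \<le> dim_polys_on x n s A"
    unfolding dim neg_inertia_index_eq_pos neg
  proof (rule pos_inertia_index_le_dim[OF assms(1) low_degree_funs_subset])
    fix f
    assume "\<And>u. u \<in> fun_vs.span ?S \<Longrightarrow> (\<Sum>a\<in>A. u a * f a) = 0"
    then show "quadratic_form A (\<lambda>a b. - ?M a b) f \<le> 0"
      using zero[of f] fun_cong[OF neg, of f] by simp
  qed
qed

theorem theorem2:
  shows
    "(\<forall>(scale :: 'a::field \<Rightarrow> 'v::ab_group_add \<Rightarrow> 'v) (Basis :: 'v set) (e :: nat \<Rightarrow> 'v) (n :: nat)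
        (A :: 'v set) (s :: nat) (p :: (nat + nat, 'a) mpoly).
        finite_dimensional_vector_space scale Basis \<longrightarrow>
        n = vector_space.dim scale (UNIV :: 'v set) \<longrightarrow>
        bij_betw e {..<n} Basis \<longrightarrow>
        finite A \<longrightarrow>
        p \<in> polys_in (two_sets_of_vars n) \<longrightarrow>
        total_degree p \<le> 2 * s + 1 \<longrightarrow>
        rank_on A (poly_matrix (coords scale Basis e) p)
          \<le> 2 * dim_polys_on (coords scale Basis e) n s A)
     \<and>
     (\<forall>(scale :: real \<Rightarrow> 'w::ab_group_add \<Rightarrow> 'w) (Basis :: 'w set) (e :: nat \<Rightarrow> 'w) (n :: nat)
        (A :: 'w set) (s :: nat) (p :: (nat + nat, real) mpoly).
        finite_dimensional_vector_space scale Basis \<longrightarrow>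
        n = vector_space.dim scale (UNIV :: 'w set) \<longrightarrow>
        bij_betw e {..<n} Basis \<longrightarrow>
        finite A \<longrightarrow>
        p \<in> polys_in (two_sets_of_vars n) \<longrightarrow>
        total_degree p \<le> 2 * s + 1 \<longrightarrow>
        max (pos_inertia_index A (quadratic_form A (poly_matrix (coords scale Basis e) p)))
            (neg_inertia_index A (quadratic_form A (poly_matrix (coords scale Basis e) p)))
          \<le> dim_polys_on (coords scale Basis e) n s A)"
  \<comment> \<open>Both bounds were proved for an arbitrary coordinate map \<open>x\<close>; here
    it is \<open>coords scale Basis e\<close>.\<close>
  by (intro conjI allI impI max.boundedI rank_on_poly_matrix_le inertia_indices_poly_matrix_le)

end
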